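(* Let $m,r,f\in\mathbb N$ with $3\le m<r<f$ be such that $\langle m,r\rangle$ is a numerical semigroup and $f\notin\langle m,r\rangle$, and let $X=\{\lambda r\bmod m\mid\lambda\in\{1,\dots,\lfloor\tfrac{f-1}{r}\rfloor\}\}\cup\{0,m\}$. If $X$ does not contain consecutive natural numbers, then $$S=\langle m,r\rangle\cup\{f+1,f+2,\dots\}\in\mathcal A(f)\quad\text{with}\quad\operatorname{rank}_{\mathcal A(f)}(S)=2.$$ Moreover, every numerical $\mathcal A$-semigroup with $\mathcal A(f)$-rank equal to two, such that its multiplicity and ratio generate a numerical semigroup, is of this form (for some $m,r\in\mathbb N$ with $3\le m<r<f$ such that $\langle m,r\rangle$ is a numerical semigroup, $f\notin\langle m,r\rangle$, and the set $\{\lambda r\bmod m\mid\lambda\in\{1,\dots,\lfloor\tfrac{f-1}{r}\rfloor\}\}\cup\{0,m\}$ does not contain consecutive natural numbers).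
   Context: $\mathbb N=\{0,1,2,\dots\}$. A numerical semigroup is a submonoid $S$ of $(\mathbb N,+)$ with finite complement. Its Frobenius number $\operatorname{Fb}(S)$ is the largest element of $\mathbb N\setminus S$ ($-1$ if $S=\mathbb N$); its multiplicity is $\operatorname{m}(S)=\min(S\setminus\{0\})$; its ratio is $\operatorname{r}(S)=\min(S\setminus\langle\operatorname{m}(S)\rangle)$, where $\langle A\rangle$ denotes the submonoid of $\mathbb N$ generated by $A$; and $\operatorname{N}(S)=\{x\in S\mid x<\operatorname{Fb}(S)\}$. $S$ is an $\mathcal A$-semigroup if there is no $s$ with $\{s,s+1\}\subseteq\operatorname{N}(S)$. For $f\ge1$, $\mathcal A(f)$ is the set of numerical $\mathcal A$-semigroups with Frobenius number $f$, and $\Delta(f)=\{0,f+1,f+2,\dots\}$. Here $a\bmod m$ is the remainder of $a$ on division by $m$. A set $X$ is an $\mathcal A(f)$-set if $X\cap\Delta(f)=\emptyset$ and there is $S\in\mathcal A(f)$ with $X\subset S$. For an $\mathcal A(f)$-set $X$, $\mathcal A(f)[X]$ is the intersection of all elements of $\mathcal A(f)$ containing $X$. $X$ is an $\mathcal A(f)$-system of generators of $S$ if $X$ is an $\mathcal A(f)$-set and $S=\mathcal A(f)[X]$; it is minimal if no proper subset $Y\subsetneq X$ satisfies $\mathcal A(f)[Y]=S$. Every $S\in\mathcal A(f)$ has a unique minimal $\mathcal A(f)$-system of generators; its cardinality is $\operatorname{rank}_{\mathcal A(f)}(S)$ (the $\mathcal A(f)$-rank). *)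

theory Defs
  imports Complex_Main
begin

definition add_submonoid :: "nat set \<Rightarrow> bool" where
  "add_submonoid S \<longleftrightarrow> 0 \<in> S \<and> (\<forall>x\<in>S. \<forall>y\<in>S. x + y \<in> S)"

definition generated :: "nat set \<Rightarrow> nat set" where
  "generated A = add_submonoid hull A"

definition numerical_semigroup :: "nat set \<Rightarrow> bool" where
  "numerical_semigroup S \<longleftrightarrow> add_submonoid S \<and> finite (- S)"

(* The value at UNIV is the convention Fb(N) = -1, hence the result type int. *)
definition Fb :: "nat set \<Rightarrow> int" where
  "Fb S = (if S = UNIV then - 1 else int (Max (- S)))"

definition multiplicity_of :: "nat set \<Rightarrow> nat" where
  "multiplicity_of S = (LEAST x. x \<in> S - {0})"

(* Meaningful only for S distinct from UNIV: otherwise S - <m(S)> is empty. *)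
definition ratio :: "nat set \<Rightarrow> nat" where
  "ratio S = (LEAST x. x \<in> S - generated {multiplicity_of S})"

definition small_elements :: "nat set \<Rightarrow> nat set" where
  "small_elements S = {x \<in> S. int x < Fb S}"

definition A_semigroup :: "nat set \<Rightarrow> bool" where
  "A_semigroup S \<longleftrightarrow>
     numerical_semigroup S \<and> \<not> (\<exists>s. {s, s + 1} \<subseteq> small_elements S)"

definition A_family :: "nat \<Rightarrow> nat set set" where
  "A_family f = {S. A_semigroup S \<and> Fb S = int f}"

definition Delta :: "nat \<Rightarrow> nat set" where
  "Delta f = insert 0 {f + 1..}"

definition A_set :: "nat \<Rightarrow> nat set \<Rightarrow> bool" where
  "A_set f X \<longleftrightarrow> X \<inter> Delta f = {} \<and> (\<exists>S\<in>A_family f. X \<subseteq> S)"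

(* Used only for A(f)-sets X, for which the intersected family is nonempty. *)
definition A_closure :: "nat \<Rightarrow> nat set \<Rightarrow> nat set" where
  "A_closure f X = \<Inter>{S \<in> A_family f. X \<subseteq> S}"

definition A_generators :: "nat \<Rightarrow> nat set \<Rightarrow> nat set \<Rightarrow> bool" where
  "A_generators f X S \<longleftrightarrow> A_set f X \<and> S = A_closure f X"

definition minimal_A_generators :: "nat \<Rightarrow> nat set \<Rightarrow> nat set \<Rightarrow> bool" where
  "minimal_A_generators f X S \<longleftrightarrow>
     A_generators f X S \<and> \<not> (\<exists>Y. Y \<subset> X \<and> A_closure f Y = S)"

(* Every S in A_family f has exactly one minimal A(f)-system of generators, and it is
   finite, being contained in {1..f}; so neither THE nor card is degenerate there. *)
definition A_rank :: "nat \<Rightarrow> nat set \<Rightarrow> nat" where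
  "A_rank f S = card (THE X. minimal_A_generators f X S)"

definition has_consecutive :: "nat set \<Rightarrow> bool" where
  "has_consecutive X \<longleftrightarrow> (\<exists>x. x \<in> X \<and> x + 1 \<in> X)"

(* Only used with 0 < r < f, so the truncated f - 1 is exact and div is the floor. *)
definition residue_set :: "nat \<Rightarrow> nat \<Rightarrow> nat \<Rightarrow> nat set" where
  "residue_set m r f = {k * r mod m | k. k \<in> {1..(f - 1) div r}} \<union> {0, m}"

end

theory Submission
  imports Defs
begin

text \<open>
  An element of \<open>A(f)\<close> is the same thing as a submonoid that omits \<open>f\<close>, contains every larger
  number, and has no two consecutive elements below \<open>f\<close> (\<open>A_family_iff\<close>). All of these
  conditions except the presence of the numbers above \<open>f\<close> pass to submonoids. So as soon as \<open>X\<close>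
  lies in some member of \<open>A(f)\<close>, the least member containing \<open>X\<close> is simply
  \<open>generated X \<union> {f + 1..}\<close> (\<open>A_closure_eq\<close>).

  Consequently generation in \<open>A(f)\<close> is governed by the elements of \<open>S\<close> up to \<open>f\<close> that are not a
  sum of two nonzero elements of \<open>S\<close>. These atoms generate \<open>S\<close>, and none of them can be left out of
  any generating system, because removing an atom from a monoid leaves a monoid. Hence the atoms
  form the only minimal system, and the rank is their number (\<open>A_rank_eq_card_atoms\<close>). Rank two
  means that \<open>S = generated {m, r} \<union> {f + 1..}\<close> for its two atoms \<open>m < r\<close>, and then \<open>m\<close> and \<open>r\<close>
  are the multiplicity and the ratio.

  What is left is to decide when \<open>generated {m, r}\<close> has two consecutive elements below \<open>f\<close>. Modulo
  \<open>m\<close> only the multiple of \<open>r\<close> in \<open>a * m + b * r\<close> matters. Conversely, two multiples of \<open>r\<close> below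
  \<open>f\<close> whose residues are consecutive become consecutive numbers once a multiple of \<open>m\<close> is added to
  one of them; they stay below \<open>f\<close> because \<open>f\<close> itself is not in the monoid. The element \<open>m\<close> of the
  residue set takes care of the wrap-around from residue \<open>m - 1\<close> to residue \<open>0\<close>
  (\<open>has_consecutive_residue_set_iff\<close>).
\<close>

section \<open>Submonoids of the natural numbers\<close>

lemma add_submonoid_generated: "add_submonoid (generated A)"
  unfolding generated_def by (rule hull_in) (auto simp: add_submonoid_def)

lemma subset_generated: "A \<subseteq> generated A"
  unfolding generated_def by (rule hull_subset)

lemma generated_subset: "A \<subseteq> S \<Longrightarrow> add_submonoid S \<Longrightarrow> generated A \<subseteq> S"
  unfolding generated_def by (rule hull_minimal)

lemma add_submonoid_mult:
  assumes "add_submonoid S" "x \<in> S"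
  shows "k * x \<in> S"
  using assms by (induction k) (auto simp: add_submonoid_def)

lemma generated_pair: "generated {m, r} = {a * m + b * r | a b. True}"
proof
  have "add_submonoid {a * m + b * r | a b. True}"
    unfolding add_submonoid_def
  proof (intro conjI ballI)
    show "0 \<in> {a * m + b * r | a b. True}" by force
  next
    fix x y assume "x \<in> {a * m + b * r | a b. True}" "y \<in> {a * m + b * r | a b. True}"
    then obtain a b c d where "x = a * m + b * r" "y = c * m + d * r" by blast
    then have "x + y = (a + c) * m + (b + d) * r" by (simp add: algebra_simps)
    then show "x + y \<in> {a * m + b * r | a b. True}" by blast
  qed
  moreover have "m = 1 * m + 0 * r" "r = 0 * m + 1 * r" by simp_all
  then have "{m, r} \<subseteq> {a * m + b * r | a b. True}" by blast
  ultimately show "generated {m, r} \<subseteq> {a * m + b * r | a b. True}"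
    by (intro generated_subset)
next
  have "m \<in> generated {m, r}" "r \<in> generated {m, r}"
    using subset_generated[of "{m, r}"] by auto
  then have "a * m + b * r \<in> generated {m, r}" for a b
    using add_submonoid_mult add_submonoid_generated[of "{m, r}"]
    by (metis add_submonoid_def)
  then show "{a * m + b * r | a b. True} \<subseteq> generated {m, r}" by blast
qed

lemma generated_singleton: "generated {m} = {x. m dvd x}"
proof
  show "generated {m} \<subseteq> {x. m dvd x}"
    by (rule generated_subset) (auto simp: add_submonoid_def)
  show "{x. m dvd x} \<subseteq> generated {m}"
    using add_submonoid_mult[OF add_submonoid_generated, of m "{m}"] subset_generated[of "{m}"]
    by (auto simp: dvd_def mult.commute)
qed

lemma generated_pair_below:
  assumes "x \<in> generated {m, r}" "x < r"
  shows "m dvd x"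
proof -
  obtain a b where x: "x = a * m + b * r" using assms(1) unfolding generated_pair by blast
  with assms(2) have "b = 0" by (cases b) auto
  with x show ?thesis by simp
qed

text \<open>If \<open>m\<close> divided \<open>r\<close>, all elements would be multiples of \<open>m\<close>, and the gaps
  \<open>k * m + 1\<close> would never end.\<close>

lemma numerical_semigroup_pair_not_dvd:
  assumes "numerical_semigroup (generated {m, r})" "2 \<le> m"
  shows "\<not> m dvd r"
proof
  assume "m dvd r"
  then have "m dvd x" if "x \<in> generated {m, r}" for x
    using that unfolding generated_pair by auto
  moreover have "\<not> m dvd k * m + 1" for k
    using dvd_add_right_iff[of m "k * m" 1] assms(2) by simp
  ultimately have "range (\<lambda>k. k * m + 1) \<subseteq> - generated {m, r}" by blast
  moreover have "infinite (range (\<lambda>k. k * m + 1))"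
    using assms(2) by (auto dest!: finite_imageD simp: inj_on_def)
  ultimately show False
    using assms(1) finite_subset unfolding numerical_semigroup_def by blast
qed

lemma add_submonoid_Un_atLeast:
  "add_submonoid S \<Longrightarrow> add_submonoid (S \<union> {n..})"
  unfolding add_submonoid_def by auto

section \<open>Members and closures in the family\<close>

text \<open>The Frobenius number is computed away, so that every condition on \<open>S\<close> becomes
  elementary. Since \<open>f\<close> is a gap, \<open>f \<le> s + 1\<close> says that the larger of two
  consecutive elements lies above \<open>f\<close>.\<close>

lemma A_family_iff:
  "S \<in> A_family f \<longleftrightarrow>
     add_submonoid S \<and> f \<notin> S \<and> {f + 1..} \<subseteq> S \<and> (\<forall>s. s \<in> S \<longrightarrow> s + 1 \<in> S \<longrightarrow> f \<le> s + 1)"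
proof -
  have Fb_iff: "Fb S = int f \<longleftrightarrow> f \<notin> S \<and> {f + 1..} \<subseteq> S" if fin: "finite (- S)"
  proof
    assume Fb: "Fb S = int f"
    then have "S \<noteq> UNIV" and Max: "Max (- S) = f" by (auto simp: Fb_def split: if_splits)
    then have "f \<in> - S" using Max_in[OF fin] by auto
    moreover have "x \<le> f" if "x \<notin> S" for x
      using Max_ge[OF fin, of x] that Max by auto
    ultimately show "f \<notin> S \<and> {f + 1..} \<subseteq> S" by force
  next
    assume f: "f \<notin> S \<and> {f + 1..} \<subseteq> S"
    then have "x \<le> f" if "x \<notin> S" for x using that
      by (intro leI) (auto simp: subset_iff Suc_le_eq)
    then have "Max (- S) = f" using f fin by (intro Max_eqI) auto
    then show "Fb S = int f" using f by (auto simp: Fb_def)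
  qed
  have fin: "finite (- S)" if "{f + 1..} \<subseteq> S"
  proof (rule finite_subset)
    show "- S \<subseteq> {..f}"
    proof
      fix x assume "x \<in> - S"
      then show "x \<in> {..f}" using that
        by (intro atMost_iff[THEN iffD2] leI) (auto simp: subset_iff Suc_le_eq)
    qed
  qed simp
  have consecutive: "(\<nexists>s. {s, s + 1} \<subseteq> small_elements S) \<longleftrightarrow>
      (\<forall>s. s \<in> S \<longrightarrow> s + 1 \<in> S \<longrightarrow> f \<le> s + 1)" if "Fb S = int f"
    using that unfolding small_elements_def by force
  show ?thesis
    unfolding A_family_def A_semigroup_def numerical_semigroup_def
    using Fb_iff fin consecutive by blast
qed

text \<open>The union is a monoid contained in \<open>S\<close>, so it inherits from \<open>S\<close> both the gap at \<open>f\<close> and the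
  absence of consecutive elements below \<open>f\<close>.\<close>

lemma generated_Un_in_A_family:
  assumes "S \<in> A_family f" "X \<subseteq> S"
  shows "generated X \<union> {f + 1..} \<in> A_family f"
proof -
  have "generated X \<union> {f + 1..} \<subseteq> S"
    using assms generated_subset[OF assms(2)] unfolding A_family_iff by auto
  then show ?thesis
    using assms(1) add_submonoid_Un_atLeast[OF add_submonoid_generated]
    unfolding A_family_iff by blast
qed

lemma A_closure_eq:
  assumes "S \<in> A_family f" "X \<subseteq> S"
  shows "A_closure f X = generated X \<union> {f + 1..}"
proof
  show "A_closure f X \<subseteq> generated X \<union> {f + 1..}"
    using generated_Un_in_A_family[OF assms] subset_generated[of X]
    unfolding A_closure_def by blast
  show "generated X \<union> {f + 1..} \<subseteq> A_closure f X"
    unfolding A_closure_def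
  proof (rule Inter_greatest)
    fix T assume T: "T \<in> {S \<in> A_family f. X \<subseteq> S}"
    then have "generated X \<subseteq> T" by (intro generated_subset) (auto simp: A_family_iff)
    with T show "generated X \<union> {f + 1..} \<subseteq> T" by (simp add: A_family_iff)
  qed
qed

section \<open>The rank counts the atoms\<close>

text \<open>The numbers above \<open>f\<close> lie in every member of \<open>A(f)\<close>, so only irreducible elements up to \<open>f\<close>
  have to be generated.\<close>

definition atoms :: "nat \<Rightarrow> nat set \<Rightarrow> nat set" where
  "atoms f S = {p \<in> S. 0 < p \<and> p \<le> f \<and> (\<forall>x\<in>S. \<forall>y\<in>S. p = x + y \<longrightarrow> x = 0 \<or> y = 0)}"

lemma atomsI:
  assumes "p \<in> S" "0 < p" "p \<le> f"
    and "\<And>x y. x \<in> S \<Longrightarrow> y \<in> S \<Longrightarrow> p = x + y \<Longrightarrow> x = 0 \<or> y = 0"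
  shows "p \<in> atoms f S"
  using assms unfolding atoms_def by blast

lemma atoms_split:
  assumes "p \<in> atoms f S" "x \<in> S" "y \<in> S" "p = x + y"
  shows "x = 0 \<or> y = 0"
  using assms unfolding atoms_def by blast

lemma generated_atoms:
  assumes "add_submonoid S" "x \<in> S" "x \<le> f"
  shows "x \<in> generated (atoms f S)"
  using assms(2,3)
proof (induction x rule: less_induct)
  case (less x)
  note monoid = add_submonoid_generated[of "atoms f S"]
  consider "x = 0" | "x \<in> atoms f S" | y z where "y \<in> S" "z \<in> S" "y \<noteq> 0" "z \<noteq> 0" "x = y + z"
    using less.prems unfolding atoms_def by blast
  then show ?case
  proof cases
    case 1
    then show ?thesis using monoid by (simp add: add_submonoid_def)
  next
    case 2
    then show ?thesis using subset_generated[of "atoms f S"] by (rule rev_subsetD)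
  next
    case 3
    then have "y \<in> generated (atoms f S)" "z \<in> generated (atoms f S)"
      using less by auto
    then show ?thesis using monoid \<open>x = y + z\<close> by (simp add: add_submonoid_def)
  qed
qed

text \<open>An atom \<open>p\<close> is not a sum of two elements other than \<open>p\<close>, so \<open>S - {p}\<close> is again a monoid;
  it contains \<open>X\<close> unless \<open>p\<close> itself lies in \<open>X\<close>.\<close>

lemma atom_in_generators:
  assumes S: "add_submonoid S" and X: "X \<subseteq> S" and p: "p \<in> atoms f S" "p \<in> generated X"
  shows "p \<in> X"
proof (rule ccontr)
  assume "p \<notin> X"
  then have "X \<subseteq> S - {p}" using X by blast
  moreover have "add_submonoid (S - {p})"
    unfolding add_submonoid_def
  proof (intro conjI ballI)
    show "0 \<in> S - {p}" using S p(1) by (simp add: add_submonoid_def atoms_def)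
    fix x y assume xy: "x \<in> S - {p}" "y \<in> S - {p}"
    have "x + y \<noteq> p"
    proof
      assume "x + y = p"
      then have "x = 0 \<or> y = 0" using atoms_split[OF p(1)] xy by blast
      then show False using xy \<open>x + y = p\<close> by auto
    qed
    then show "x + y \<in> S - {p}" using S xy by (simp add: add_submonoid_def)
  qed
  ultimately have "generated X \<subseteq> S - {p}" by (rule generated_subset)
  then show False using p(2) by blast
qed

text \<open>The atoms generate \<open>S\<close>, and every generating system contains them. So they are minimal, and a
  generating system with anything more is not.\<close>

lemma minimal_A_generators_iff:
  assumes S: "S \<in> A_family f"
  shows "minimal_A_generators f X S \<longleftrightarrow> X = atoms f S"
proof -
  have monoid: "add_submonoid S" and big: "{f + 1..} \<subseteq> S" using S by (auto simp: A_family_iff)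
  have atoms_sub: "atoms f S \<subseteq> S" by (auto simp: atoms_def)
  have "S \<subseteq> generated (atoms f S) \<union> {f + 1..}"
    using generated_atoms[OF monoid] by (auto simp: not_le[symmetric] Suc_le_eq)
  moreover have "generated (atoms f S) \<union> {f + 1..} \<subseteq> S"
    using generated_subset[OF atoms_sub monoid] big by simp
  ultimately have closure: "A_closure f (atoms f S) = S"
    using A_closure_eq[OF S atoms_sub] by blast
  have contains: "atoms f S \<subseteq> Y" if "Y \<subseteq> S" "A_closure f Y = S" for Y
  proof
    fix p assume p: "p \<in> atoms f S"
    then have "p \<in> generated Y"
      using A_closure_eq[OF S that(1)] that(2) by (auto simp: atoms_def)
    then show "p \<in> Y" using atom_in_generators[OF monoid that(1) p] by blast
  qed
  show ?thesis
  proof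
    assume X: "minimal_A_generators f X S"
    then obtain T where "T \<in> A_family f" "X \<subseteq> T" and X_closure: "A_closure f X = S"
      unfolding minimal_A_generators_def A_generators_def A_set_def by auto
    then have "X \<subseteq> S" by (auto simp: A_closure_def)
    then have "atoms f S \<subseteq> X" using contains X_closure by blast
    then show "X = atoms f S"
      using X closure unfolding minimal_A_generators_def by blast
  next
    assume X: "X = atoms f S"
    have "atoms f S \<inter> Delta f = {}" by (auto simp: atoms_def Delta_def)
    then have "A_generators f X S"
      unfolding A_generators_def A_set_def using X S atoms_sub closure by blast
    moreover have False if "Y \<subset> atoms f S" "A_closure f Y = S" for Y
      using that contains[of Y] atoms_sub by blast
    ultimately show "minimal_A_generators f X S"
      unfolding minimal_A_generators_def X by blast
  qed
qed

corollary A_rank_eq_card_atoms: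
  assumes "S \<in> A_family f"
  shows "A_rank f S = card (atoms f S)"
  unfolding A_rank_def using minimal_A_generators_iff[OF assms] by simp

lemma eq_generated_atoms_Un:
  assumes "S \<in> A_family f"
  shows "S = generated (atoms f S) \<union> {f + 1..}"
  using minimal_A_generators_iff[OF assms, of "atoms f S"] A_closure_eq[OF assms, of "atoms f S"]
  unfolding minimal_A_generators_def A_generators_def atoms_def by blast

section \<open>Consecutive elements in a monoid with two generators\<close>

text \<open>Allowing the multiplier \<open>0\<close> absorbs the additional element \<open>0\<close>, and the multiples of \<open>r\<close>
  concerned are exactly those below \<open>f\<close>.\<close>

lemma residue_set_eq:
  assumes "0 < r" "0 < f"
  shows "residue_set m r f = insert m {k * r mod m | k. k * r < f}"
proof -
  have bound: "k \<le> (f - 1) div r \<longleftrightarrow> k * r < f" for k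
    using assms by (auto simp: less_eq_div_iff_mult_less_eq)
  have "residue_set m r f = insert m ((\<lambda>k. k * r mod m) ` insert 0 {1..(f - 1) div r})"
    unfolding residue_set_def by auto
  also have "insert 0 {1..(f - 1) div r} = {k. k * r < f}"
    unfolding bound[symmetric] by auto
  finally show ?thesis by auto
qed

text \<open>Consecutive elements give consecutive residues, except when \<open>s\<close> has residue \<open>m - 1\<close>; in that
  case \<open>m - 1\<close> and \<open>m\<close> are consecutive in the residue set. In the other direction, \<open>u\<close> and \<open>v\<close>
  are multiples of \<open>r\<close> below \<open>f\<close> with \<open>u + 1\<close> congruent to \<open>v\<close> modulo \<open>m\<close>; raising the smaller
  one of \<open>u + 1\<close> and \<open>v\<close> to the larger by a multiple of \<open>m\<close> puts both \<open>s\<close> and \<open>s + 1\<close> into the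
  monoid.\<close>

lemma has_consecutive_residue_set_iff:
  assumes m: "2 \<le> m" and r: "0 < r" and f: "0 < f" "f \<notin> generated {m, r}"
  shows "has_consecutive (residue_set m r f) \<longleftrightarrow>
    (\<exists>s. s \<in> generated {m, r} \<and> s + 1 \<in> generated {m, r} \<and> s + 1 < f)"
proof
  assume "\<exists>s. s \<in> generated {m, r} \<and> s + 1 \<in> generated {m, r} \<and> s + 1 < f"
  then obtain s a b c d where s: "s = a * m + b * r" "s + 1 = c * m + d * r" "s + 1 < f"
    unfolding generated_pair by blast
  then have "b * r < f" "d * r < f" by linarith+
  then have in_set: "b * r mod m \<in> residue_set m r f" "d * r mod m \<in> residue_set m r f"
      "m \<in> residue_set m r f"
    unfolding residue_set_eq[OF r f(1)] by blast+
  have residues: "s mod m = b * r mod m" "(s + 1) mod m = d * r mod m"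
    using s by simp_all
  show "has_consecutive (residue_set m r f)"
  proof (cases "s mod m + 1 = m")
    case True
    then show ?thesis using in_set residues unfolding has_consecutive_def by metis
  next
    case False
    then have "(s + 1) mod m = s mod m + 1" by (simp add: mod_Suc)
    then show ?thesis using in_set residues unfolding has_consecutive_def by metis
  qed
next
  assume "has_consecutive (residue_set m r f)"
  then obtain x where x: "x \<in> residue_set m r f" "x + 1 \<in> residue_set m r f"
    unfolding has_consecutive_def by blast
  have residue_less: "k * r mod m < m" for k using m by simp
  have "x \<noteq> m"
  proof
    assume "x = m"
    then obtain k where "m + 1 = k * r mod m"
      using x(2) unfolding residue_set_eq[OF r f(1)] by auto
    then show False using residue_less[of k] by simp
  qed
  then obtain b where b: "x = b * r mod m" "b * r < f"
    using x(1) unfolding residue_set_eq[OF r f(1)] by blast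
  obtain d where d: "(x + 1) mod m = d * r mod m" "d * r < f"
  proof (cases "x + 1 = m")
    case True
    then show thesis using that[of 0] f(1) by simp
  next
    case False
    then show thesis using that x(2) unfolding residue_set_eq[OF r f(1)] by auto
  qed
  define u v where "u = b * r" and "v = d * r"
  have "(u + 1) mod m = v mod m"
    using b(1) d(1) unfolding u_def v_def by (metis mod_add_left_eq)
  have mem: "a * m + u \<in> generated {m, r}" "a * m + v \<in> generated {m, r}" for a
    unfolding generated_pair u_def v_def by blast+
  show "\<exists>s. s \<in> generated {m, r} \<and> s + 1 \<in> generated {m, r} \<and> s + 1 < f"
  proof (cases "u + 1 \<le> v")
    case True
    then obtain a where "v = u + 1 + m * a"
      using mod_eq_nat1E \<open>(u + 1) mod m = v mod m\<close> by metis
    then have "v = a * m + u + 1" by simp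
    then show ?thesis
      using mem(1)[of a] mem(2)[of 0] d(2) unfolding v_def[symmetric]
      by (intro exI[of _ "a * m + u"]) simp
  next
    case False
    then have "v \<le> u + 1" by simp
    then obtain a where "u + 1 = v + m * a"
      using mod_eq_nat1E \<open>(u + 1) mod m = v mod m\<close> by metis
    then have "u + 1 \<in> generated {m, r}" using mem(2)[of a] by (simp add: ac_simps)
    \<comment> \<open>here \<open>u < f\<close> yields only \<open>u + 1 \<le> f\<close>; equality is ruled out because \<open>f\<close> is a gap\<close>
    moreover from this have "u + 1 \<noteq> f" using f(2) by metis
    then have "u + 1 < f" using b(2) unfolding u_def by linarith
    moreover have "u \<in> generated {m, r}" using mem(1)[of 0] by simp
    ultimately show ?thesis by blast
  qed
qed

corollary generated_pair_Un_in_A_family_iff: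
  assumes "2 \<le> m" "0 < r" "0 < f" "f \<notin> generated {m, r}"
  shows "generated {m, r} \<union> {f + 1..} \<in> A_family f \<longleftrightarrow> \<not> has_consecutive (residue_set m r f)"
proof -
  let ?G = "generated {m, r}"
  have "add_submonoid (?G \<union> {f + 1..})"
    by (rule add_submonoid_Un_atLeast[OF add_submonoid_generated])
  moreover have "x \<in> ?G \<union> {f + 1..} \<longleftrightarrow> x \<in> ?G" if "x < f" for x using that by auto
  ultimately show ?thesis
    unfolding has_consecutive_residue_set_iff[OF assms] A_family_iff
    using assms(4) by (metis Un_iff Un_upper2 add_lessD1 atLeast_iff not_less not_add_less1 less_add_one)
qed

section \<open>Semigroups of rank two\<close>

lemma atoms_generated_pair_Un:
  assumes "0 < m" "m < r" "r \<le> f" "\<not> m dvd r"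
  shows "atoms f (generated {m, r} \<union> {f + 1..}) = {m, r}"
proof
  let ?S = "generated {m, r} \<union> {f + 1..}"
  have monoid: "add_submonoid ?S"
    by (rule add_submonoid_Un_atLeast[OF add_submonoid_generated])
  have gens: "{m, r} \<subseteq> ?S" using subset_generated[of "{m, r}"] by blast
  show "atoms f ?S \<subseteq> {m, r}"
    using atom_in_generators[OF monoid gens] by (auto simp: atoms_def)
  have below: "m dvd x" if "x \<in> ?S" "x < r" for x
    using that generated_pair_below assms(3) by auto
  have "m \<in> atoms f ?S"
  proof (rule atomsI)
    show "m \<in> ?S" using gens by blast
    show "0 < m" "m \<le> f" using assms by auto
    fix x y assume xy: "x \<in> ?S" "y \<in> ?S" "m = x + y"
    then have "x < r" using assms(2) by simp
    then have "m dvd x" using below xy(1) by blast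
    then show "x = 0 \<or> y = 0" using xy(3) by (auto dest: dvd_imp_le)
  qed
  moreover have "r \<in> atoms f ?S"
  proof (rule atomsI)
    show "r \<in> ?S" using gens by blast
    show "0 < r" "r \<le> f" using assms by auto
    fix x y assume xy: "x \<in> ?S" "y \<in> ?S" "r = x + y"
    show "x = 0 \<or> y = 0"
    proof (rule ccontr)
      assume "\<not> (x = 0 \<or> y = 0)"
      then have "m dvd x" "m dvd y" using below xy by auto
      then show False using xy(3) assms(4) by simp
    qed
  qed
  ultimately show "{m, r} \<subseteq> atoms f ?S" by blast
qed

lemma multiplicity_of_generated_pair_Un:
  assumes "0 < m" "m < r" "r \<le> f"
  shows "multiplicity_of (generated {m, r} \<union> {f + 1..}) = m"
  unfolding multiplicity_of_def
proof (rule Least_equality)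
  show "m \<in> generated {m, r} \<union> {f + 1..} - {0}"
    using subset_generated[of "{m, r}"] assms(1) by blast
  fix x assume x: "x \<in> generated {m, r} \<union> {f + 1..} - {0}"
  show "m \<le> x"
  proof (cases "x < r")
    case True
    then have "m dvd x" using x assms generated_pair_below by auto
    then show ?thesis using x by (auto dest: dvd_imp_le)
  next
    case False
    then show ?thesis using assms by simp
  qed
qed

lemma ratio_generated_pair_Un:
  assumes "0 < m" "m < r" "r \<le> f" "\<not> m dvd r"
  shows "ratio (generated {m, r} \<union> {f + 1..}) = r"
  unfolding ratio_def multiplicity_of_generated_pair_Un[OF assms(1-3)] generated_singleton
proof (rule Least_equality)
  show "r \<in> generated {m, r} \<union> {f + 1..} - {x. m dvd x}"
    using subset_generated[of "{m, r}"] assms(4) by blast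
  fix x assume "x \<in> generated {m, r} \<union> {f + 1..} - {x. m dvd x}"
  then show "r \<le> x"
    using generated_pair_below assms(3) by (force simp: not_le)
qed

text \<open>The two generators are the atoms. A larger atom that is a multiple of the smaller one would
  split. Hence the smaller one is not \<open>1\<close>; it is not \<open>2\<close> either, since then the odd
  atom \<open>r\<close> and its predecessor would be consecutive elements below \<open>f\<close>.\<close>

lemma rank_two_obtains_generators:
  assumes S: "S \<in> A_family f" and rank: "A_rank f S = 2"
  obtains m r where "3 \<le> m" "m < r" "r < f" "\<not> m dvd r" "f \<notin> generated {m, r}"
    "S = generated {m, r} \<union> {f + 1..}"
proof -
  have monoid: "add_submonoid S" and gap: "f \<notin> S"
    and consecutive: "\<And>s. s \<in> S \<Longrightarrow> s + 1 \<in> S \<Longrightarrow> f \<le> s + 1"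
    using S by (auto simp: A_family_iff)
  obtain p q where "atoms f S = {p, q}" "p \<noteq> q"
    using rank unfolding A_rank_eq_card_atoms[OF S] card_2_iff by blast
  then obtain m r where atoms: "atoms f S = {m, r}" and less: "m < r"
    by (metis insert_commute linorder_neqE_nat)
  then have S_eq: "S = generated {m, r} \<union> {f + 1..}" using eq_generated_atoms_Un[OF S] by simp
  have mem: "m \<in> atoms f S" "r \<in> atoms f S" using atoms by simp_all
  then have m: "m \<in> S" "0 < m" and r: "r \<in> S" "r \<le> f" by (auto simp: atoms_def)
  have "r < f" using r gap by (metis le_neq_implies_less)
  have not_dvd: "\<not> m dvd r"
  proof
    assume "m dvd r"
    then obtain k where "r = k * m" by (metis dvd_def mult.commute)
    with less obtain k' where "r = m + k' * m" "k' * m \<noteq> 0" by (cases k) auto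
    moreover have "k' * m \<in> S" using add_submonoid_mult[OF monoid m(1)] .
    ultimately show False using atoms_split[OF mem(2) m(1), of "k' * m"] m(2) by simp
  qed
  have "m \<noteq> 1" using not_dvd by auto
  moreover have "m \<noteq> 2"
  proof
    assume "m = 2"
    then obtain k where k: "r = k * 2 + 1" using not_dvd by (metis oddE mult.commute)
    have "k * 2 \<in> S" using add_submonoid_mult[OF monoid m(1)] \<open>m = 2\<close> by blast
    then show False using consecutive[of "k * 2"] r(1) k \<open>r < f\<close> by simp
  qed
  ultimately have "3 \<le> m" using m(2) by linarith
  then show thesis using that less \<open>r < f\<close> not_dvd S_eq gap by blast
qed

theorem theorem18:
  shows "(\<forall>m r f :: nat.
            3 \<le> m \<and> m < r \<and> r < f \<and>
            numerical_semigroup (generated {m, r}) \<and> f \<notin> generated {m, r} \<and>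
            \<not> has_consecutive (residue_set m r f)
            \<longrightarrow> generated {m, r} \<union> {f + 1..} \<in> A_family f \<and>
                A_rank f (generated {m, r} \<union> {f + 1..}) = 2)
       \<and> (\<forall>(f :: nat) (S :: nat set).
            1 \<le> f \<and> S \<in> A_family f \<and> A_rank f S = 2 \<and>
            numerical_semigroup (generated {multiplicity_of S, ratio S})
            \<longrightarrow> (\<exists>m r :: nat.
                  3 \<le> m \<and> m < r \<and> r < f \<and>
                  numerical_semigroup (generated {m, r}) \<and> f \<notin> generated {m, r} \<and>
                  \<not> has_consecutive (residue_set m r f) \<and>
                  S = generated {m, r} \<union> {f + 1..}))"
proof (intro conjI allI impI; (elim conjE)?)
  fix m r f :: nat
  assume hyps: "3 \<le> m" "m < r" "r < f" "numerical_semigroup (generated {m, r})"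
    "f \<notin> generated {m, r}" "\<not> has_consecutive (residue_set m r f)"
  then show member: "generated {m, r} \<union> {f + 1..} \<in> A_family f"
    using generated_pair_Un_in_A_family_iff[of m r f] by simp
  have "\<not> m dvd r" using numerical_semigroup_pair_not_dvd hyps by simp
  then show "A_rank f (generated {m, r} \<union> {f + 1..}) = 2"
    unfolding A_rank_eq_card_atoms[OF member]
    using hyps atoms_generated_pair_Un[of m r f] by simp
next
  fix f :: nat and S :: "nat set"
  assume S: "S \<in> A_family f" "A_rank f S = 2"
    and numerical: "numerical_semigroup (generated {multiplicity_of S, ratio S})"
  obtain m r where mr: "3 \<le> m" "m < r" "r < f" "\<not> m dvd r" "f \<notin> generated {m, r}"
    and S_eq: "S = generated {m, r} \<union> {f + 1..}"
    using rank_two_obtains_generators[OF S] .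
  have "multiplicity_of S = m" "ratio S = r"
    unfolding S_eq
    using mr multiplicity_of_generated_pair_Un[of m r f] ratio_generated_pair_Un[of m r f]
    by simp_all
  then have "numerical_semigroup (generated {m, r})" using numerical by simp
  moreover have "\<not> has_consecutive (residue_set m r f)"
    using S(1) mr generated_pair_Un_in_A_family_iff[of m r f] unfolding S_eq by simp
  ultimately show "\<exists>m r. 3 \<le> m \<and> m < r \<and> r < f \<and> numerical_semigroup (generated {m, r}) \<and>
      f \<notin> generated {m, r} \<and> \<not> has_consecutive (residue_set m r f) \<and>
      S = generated {m, r} \<union> {f + 1..}"
    using mr S_eq by (intro exI[of _ m] exI[of _ r] conjI)
qed

end
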